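(* Let $f\in\mathcal{S}^*$, let $\lambda>0$, and write $$\left(\frac{f(z)}{z}\right)^{-\lambda}=1+\sum_{n=1}^{\infty}a_n(-\lambda,f)z^n,\qquad|z|<1.$$ Then: (i) if $0<\lambda\le1$, then $$|a_l(-\lambda,f)|\le\frac{2\lambda}{l},\qquad l=1,2,\ldots; \tag{a}$$ (ii) if $\lambda>1$, then $$|a_l(-\lambda,f)|\le\prod_{j=0}^{l-1}\frac{2\lambda-j}{j+1},\qquad l=1,2,\ldots,[\lambda]+1, \tag{b}$$ and $$|a_l(-\lambda,f)|\le\left(\frac{[\lambda]+1}{l}\right)\prod_{j=0}^{[\lambda]}\frac{2\lambda-j}{j+1},\qquad l=[\lambda]+2,[\lambda]+3,\ldots$$ The inequalities (a) and (b) are sharp.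
   Context: $\mathcal{S}^*$ is the class of starlike functions: analytic $f(z)=z+\sum_{n=2}^\infty a_nz^n$ in the unit disk $\mathbb{D}=\{|z|<1\}$ satisfying $\frac{zf'(z)}{f(z)}\prec\frac{1+z}{1-z}$ in $\mathbb{D}$, where $\prec$ denotes subordination of analytic functions in $\mathbb{D}$. Such $f$ are univalent, so $f(z)/z$ is zero-free in $\mathbb{D}$, and $(f(z)/z)^{-\lambda}$ denotes the analytic branch with value $1$ at $z=0$. $[\lambda]$ denotes the greatest integer $\le\lambda$. An inequality is called sharp if, for each admissible $\lambda$ and $l$, equality is attained by some function in $\mathcal{S}^*$. *)

theory Defs
  imports "HOL-Complex_Analysis.Complex_Analysis"
begin

definition subordinate :: "(complex \<Rightarrow> complex) \<Rightarrow> (complex \<Rightarrow> complex) \<Rightarrow> bool" where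
  "subordinate F G \<longleftrightarrow>
     F holomorphic_on ball 0 1 \<and> G holomorphic_on ball 0 1 \<and>
     (\<exists>w. w holomorphic_on ball 0 1 \<and> w 0 = 0 \<and>
          (\<forall>z\<in>ball 0 1. norm (w z) < 1 \<and> F z = G (w z)))"

text \<open>
  At the origin the quotient \<open>z f'(z) / f(z)\<close> is given its limit 1.  A further zero \<open>z\<close> of \<open>f\<close>
  in the disk is excluded by the subordination: division by zero would make the quotient 0 at
  that point, but \<open>(1 + w) / (1 - w)\<close> omits 0 for \<open>\<bar>w\<bar> < 1\<close>.
\<close>

definition starlike_class :: "(complex \<Rightarrow> complex) set" where
  "starlike_class =
     {f. f holomorphic_on ball 0 1 \<and> f 0 = 0 \<and> deriv f 0 = 1 \<and>
         subordinate (\<lambda>z. if z = 0 then 1 else z * deriv f z / f z)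
                     (\<lambda>z. (1 + z) / (1 - z))}"

text \<open>
  \<open>is_log_quotient f h\<close>: \<open>h\<close> is the analytic branch of \<open>log (f(z)/z)\<close> on the unit disk that
  vanishes at the origin.  It determines \<open>h\<close> only on the disk, hence the use of \<open>SOME\<close> below; see
  \<open>is_log_quotient_unique\<close> and \<open>starlike_class_log_quotient_exists\<close>.
\<close>

definition is_log_quotient :: "(complex \<Rightarrow> complex) \<Rightarrow> (complex \<Rightarrow> complex) \<Rightarrow> bool" where
  "is_log_quotient f h \<longleftrightarrow>
     h holomorphic_on ball 0 1 \<and> h 0 = 0 \<and>
     (\<forall>z\<in>ball 0 1 - {0}. exp (h z) = f z / z)"

definition quotient_power :: "real \<Rightarrow> (complex \<Rightarrow> complex) \<Rightarrow> complex \<Rightarrow> complex" where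
  "quotient_power \<mu> f z = exp (of_real \<mu> * (SOME h. is_log_quotient f h) z)"

definition power_coeff :: "real \<Rightarrow> (complex \<Rightarrow> complex) \<Rightarrow> nat \<Rightarrow> complex" where
  "power_coeff \<mu> f n = (deriv ^^ n) (quotient_power \<mu> f) 0 / fact n"

lemma is_log_quotient_unique:
  assumes "is_log_quotient f h" "is_log_quotient f k" "z \<in> ball 0 1"
  shows "h z = k z"
proof -
  have hk: "h holomorphic_on ball 0 1" "k holomorphic_on ball 0 1" "h 0 = 0" "k 0 = 0"
    "\<And>z. z \<in> ball 0 1 - {0} \<Longrightarrow> exp (h z) = exp (k z)"
    using assms by (auto simp: is_log_quotient_def)
  have e: "exp (h z - k z) = 1" if "z \<in> ball 0 1" for z
    using hk(3-5) that by (cases "z = 0") (auto simp: exp_diff)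
  have "deriv (\<lambda>z. h z - k z) z = 0" if z: "z \<in> ball 0 1" for z
  proof -
    let ?d = "\<lambda>z. h z - k z"
    have d: "(?d has_field_derivative deriv ?d z) (at z)"
      by (rule holomorphic_derivI[OF _ open_ball z]) (intro holomorphic_intros hk)
    have "((\<lambda>z. exp (?d z)) has_field_derivative exp (?d z) * deriv ?d z) (at z)"
      using d by (rule DERIV_fun_exp)
    moreover have "((\<lambda>z. exp (?d z)) has_field_derivative 0) (at z)"
      by (rule has_field_derivative_transform_within_open[OF DERIV_const open_ball z, of 1])
        (simp add: e)
    ultimately show ?thesis
      using DERIV_unique by fastforce
  qed
  then have d0: "((\<lambda>z. h z - k z) has_field_derivative 0) (at z within ball 0 1)"
    if "z \<in> ball 0 1" for z
    using holomorphic_derivI[OF holomorphic_on_diff[OF hk(1,2)] open_ball that,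
        THEN has_field_derivative_at_within] that by simp
  have "\<exists>c. \<forall>z\<in>ball 0 1. h z - k z = c"
    by (rule has_field_derivative_zero_constant[OF convex_ball d0])
  then obtain c where c: "\<forall>z\<in>ball 0 1. h z - k z = c" ..
  then have "h 0 - k 0 = c" "h z - k z = c"
    using assms(3) by simp_all
  then show ?thesis
    using hk(3,4) by simp
qed

lemma starlike_class_nonzero:
  assumes "f \<in> starlike_class" "z \<in> ball 0 1" "z \<noteq> 0"
  shows "f z \<noteq> 0"
proof
  assume "f z = 0"
  obtain w where w: "\<forall>z\<in>ball 0 1. norm (w z) < 1 \<and>
      (if z = 0 then 1 else z * deriv f z / f z) = (1 + w z) / (1 - w z)"
    using assms(1) unfolding starlike_class_def subordinate_def by blast
  with assms(2,3) \<open>f z = 0\<close> have "norm (w z) < 1" "(1 + w z) / (1 - w z) = 0"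
    using bspec[OF w assms(2)] by simp_all
  moreover from this(2) have "1 + w z = 0 \<or> 1 - w z = 0"
    by (simp only: divide_eq_0_iff)
  then have "w z = -1 \<or> w z = 1"
    by (auto simp: eq_neg_iff_add_eq_0 add.commute)
  ultimately show False
    by auto
qed

lemma starlike_class_log_quotient_exists:
  assumes f: "f \<in> starlike_class"
  shows "\<exists>h. is_log_quotient f h"
proof -
  define q where "q = (\<lambda>z. if z = 0 then 1 else f z / z)"
  have f': "f holomorphic_on ball 0 1" "f 0 = 0" "deriv f 0 = 1"
    using f by (auto simp: starlike_class_def)
  have "q holomorphic_on ball 0 1"
    by (rule pole_theorem_open_0[of f _ 0]) (use f' in \<open>auto simp: q_def\<close>)
  moreover have "q z \<noteq> 0" if "z \<in> ball 0 1" for z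
    using starlike_class_nonzero[OF f that] by (auto simp: q_def)
  ultimately obtain g where g: "g holomorphic_on ball 0 1" "\<And>z. z \<in> ball 0 1 \<Longrightarrow> exp (g z) = q z"
    using holomorphic_logarithm_exists[of "ball 0 1" q 0] by auto
  have "exp (g 0) = 1"
    using g(2)[of 0] by (simp add: q_def)
  then have "is_log_quotient f (\<lambda>z. g z - g 0)"
    unfolding is_log_quotient_def
    using g by (auto intro!: holomorphic_intros simp: exp_diff q_def)
  then show ?thesis
    by (intro exI[of _ "\<lambda>z. g z - g 0"])
qed

lemma quotient_power_expansion:
  assumes "f \<in> starlike_class" "norm z < 1"
  shows "(\<lambda>n. power_coeff \<mu> f n * z ^ n) sums quotient_power \<mu> f z"
proof -
  have "is_log_quotient f (SOME h. is_log_quotient f h)"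
    using starlike_class_log_quotient_exists[OF assms(1)] by (rule someI_ex)
  then have "quotient_power \<mu> f holomorphic_on ball 0 1"
    unfolding quotient_power_def is_log_quotient_def by (auto intro!: holomorphic_intros)
  from holomorphic_power_series[OF this, of z] assms(2) show ?thesis
    by (simp add: power_coeff_def)
qed

end

theory Submission
  imports Defs
begin

text \<open>
  The proof is Clunie's coefficient method.  Write the subordination as
  \<open>z f'(z) / f(z) = (1 + w(z)) / (1 - w(z))\<close> with \<open>\<bar>w\<bar> < 1\<close> and \<open>w(0) = 0\<close>.  For
  \<open>g = (f(z)/z)\<^sup>\<mu> = \<Sum> a\<^sub>n z\<^sup>n\<close>, logarithmic differentiation gives
  \<open>z g' = w \<cdot> (z g' + 2 \<mu> g)\<close>, that is,
  \<open>\<Sum> n a\<^sub>n z\<^sup>n = w(z) \<cdot> \<Sum> (n + 2 \<mu>) a\<^sub>n z\<^sup>n\<close>.  Since \<open>w\<close> vanishes at the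
  origin, the coefficients on the left up to index \<open>l\<close> depend only on the terms of the right-hand
  sum with index below \<open>l\<close>.  Truncating that sum to a polynomial, using \<open>\<bar>w\<bar> < 1\<close> and
  comparing mean squares on circles gives (\<open>clunie_inequality\<close>)
  \<open>\<Sum>\<^bsub>n \<le> l\<^esub> n\<^sup>2 \<bar>a\<^sub>n\<bar>\<^sup>2 \<le> \<Sum>\<^bsub>n < l\<^esub> (n + 2 \<mu>)\<^sup>2 \<bar>a\<^sub>n\<bar>\<^sup>2\<close>.

  For \<open>\<mu> = - \<lambda>\<close> this reads
  \<open>l\<^sup>2 \<bar>a\<^sub>l\<bar>\<^sup>2 \<le> \<Sum>\<^bsub>n < l\<^esub> 4 \<lambda> (\<lambda> - n) \<bar>a\<^sub>n\<bar>\<^sup>2\<close>.  The binomial coefficients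
  \<open>2\<lambda> gchoose n\<close>, which are up to the sign \<open>(-1)\<^sup>n\<close> the coefficients for the Koebe function,
  satisfy it with equality (\<open>gbinomial_telescope\<close>).  As long as the weights \<open>\<lambda> - n\<close> are nonnegative,
  induction therefore yields \<open>\<bar>a\<^sub>l\<bar> \<le> 2\<lambda> gchoose l\<close> (\<open>power_coeff_le_gbinomial\<close>).  As soon
  as they are nonpositive, the further terms can be dropped, so \<open>l \<bar>a\<^sub>l\<bar>\<close> never exceeds the
  bound on \<open>m \<bar>a\<^sub>m\<bar>\<close> at the threshold index \<open>m\<close> (\<open>power_coeff_decay\<close>).  The
  case \<open>\<lambda> \<le> 1\<close> is the threshold \<open>m = 1\<close>; the case \<open>\<lambda> > 1\<close> has \<open>m = \<lfloor>\<lambda>\<rfloor> + 1\<close>.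

  For sharpness, the choice \<open>w(z) = z\<^sup>k\<close> belongs to \<open>f(z) = z (1 - z\<^sup>k)\<^bsup>-2/k\<^esup>\<close>, and the
  same power series identity then becomes a recurrence that determines the coefficients.  The Koebe
  function, \<open>k = 1\<close>, attains the binomial bounds, and \<open>k = l\<close> attains \<open>2 \<lambda> / l\<close>.
\<close>

\<comment> \<open>\<open>$\<close> is to denote only the coefficients of formal power series.\<close>
unbundle no vec_syntax

section \<open>Mean squares on circles\<close>

text \<open>
  On \<open>\<bar>z\<bar> = r\<close> one has \<open>cnj z = r\<^sup>2 / z\<close>, which turns the mean of \<open>F \<cdot> cnj z\<^sup>n\<close> into Cauchy's
  integral for the \<open>n\<close>-th Taylor coefficient.
\<close>

lemma circle_mean_coefficient:
  fixes r :: real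
  assumes F: "F holomorphic_on ball 0 1" "F has_fps_expansion A" and r: "0 < r" "r < 1"
  shows "((\<lambda>t. F (circlepath 0 r t) * cnj (circlepath 0 r t) ^ n)
           has_integral of_real (r ^ (2 * n)) * A $ n) {0..1}"
proof -
  have cancel: "x / y * (y * a) = x * a" if "y \<noteq> 0" for x y a :: complex
    using that by simp
  have vd: "vector_derivative (circlepath 0 r) (at t) = 2 * pi * \<i> * circlepath 0 r t" for t
    unfolding vector_derivative_circlepath by (simp add: circlepath mult_ac)
  have "((\<lambda>u. F u / u ^ Suc n) has_contour_integral
          (2 * pi * \<i>) / fact n * (deriv ^^ n) F 0) (circlepath 0 r)"
    by (rule Cauchy_has_contour_integral_higher_derivative_circlepath
        [of 0 r F 0 n, unfolded diff_zero])
      (use F(1) r in \<open>auto intro!: holomorphic_on_imp_continuous_on elim: holomorphic_on_subset\<close>)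
  also have "(2 * pi * \<i>) / fact n * (deriv ^^ n) F 0 = 2 * pi * \<i> * A $ n"
    by (simp add: fps_nth_fps_expansion[OF F(2)])
  finally have "((\<lambda>t. F (circlepath 0 r t) / circlepath 0 r t ^ Suc n *
          (2 * pi * \<i> * circlepath 0 r t)) has_integral 2 * pi * \<i> * A $ n) {0..1}"
    unfolding has_contour_integral vd .
  note has_integral_mult_right[OF this, of "of_real (r ^ (2 * n)) / (2 * pi * \<i>)"]
  also have "of_real (r ^ (2 * n)) / (2 * pi * \<i>) * (2 * pi * \<i> * A $ n) = of_real (r ^ (2 * n)) * A $ n"
    by (rule cancel) simp
  finally
  have "((\<lambda>t. of_real (r ^ (2 * n)) / (2 * pi * \<i>) *
          (F (circlepath 0 r t) / circlepath 0 r t ^ Suc n * (2 * pi * \<i> * circlepath 0 r t)))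
          has_integral of_real (r ^ (2 * n)) * A $ n) {0..1}"
    .
  moreover have "of_real (r ^ (2 * n)) / (2 * pi * \<i>) * (F z / z ^ Suc n * (2 * pi * \<i> * z)) =
      F z * cnj z ^ n" if "z = circlepath 0 r t" for z t
  proof -
    have "norm z = r"
      using that r by (simp add: circlepath norm_mult)
    then have "of_real (r\<^sup>2) = z * cnj z" "z \<noteq> 0"
      using r complex_norm_square[of z] by auto
    then have "of_real (r ^ (2 * n)) = z ^ n * cnj z ^ n"
      by (metis of_real_power power_mult power_mult_distrib)
    then show ?thesis
      using \<open>z \<noteq> 0\<close> by (simp add: field_simps)
  qed
  ultimately show ?thesis
    by simp
qed

lemma circle_mean_polynomial:
  fixes r :: real
  assumes F: "F holomorphic_on ball 0 1" "F has_fps_expansion A" and r: "0 < r" "r < 1"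
  shows "((\<lambda>t. F (circlepath 0 r t) * cnj (\<Sum>n<N. q n * circlepath 0 r t ^ n))
           has_integral (\<Sum>n<N. of_real (r ^ (2 * n)) * (A $ n * cnj (q n)))) {0..1}"
proof -
  have "((\<lambda>t. \<Sum>n<N. cnj (q n) * (F (circlepath 0 r t) * cnj (circlepath 0 r t) ^ n))
           has_integral (\<Sum>n<N. cnj (q n) * (of_real (r ^ (2 * n)) * A $ n))) {0..1}"
    by (intro has_integral_sum has_integral_mult_right circle_mean_coefficient assms) auto
  then show ?thesis
    by (simp add: sum_distrib_left mult_ac)
qed

lemma polynomial_has_fps_expansion:
  "(\<lambda>z::complex. \<Sum>n<N. q n * z ^ n) has_fps_expansion Abs_fps (\<lambda>n. if n < N then q n else 0)"
proof -
  have "(\<lambda>z. \<Sum>n<N. q n * z ^ n) has_fps_expansion (\<Sum>n<N. fps_const (q n) * fps_X ^ n)"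
    by (intro fps_expansion_intros)
  also have "(\<Sum>n<N. fps_const (q n) * fps_X ^ n) = Abs_fps (\<lambda>n. if n < N then q n else 0)"
    by (rule fps_ext) (simp add: fps_sum_nth fps_X_power_nth if_distrib cong: if_cong)
  finally show ?thesis .
qed

text \<open>
  With \<open>Q\<close> the \<open>N\<close>-th partial sum of the Taylor series of \<open>F\<close>, orthogonality of the powers of
  \<open>z\<close> on the circle makes the means of \<open>F \<cdot> cnj Q\<close> and of \<open>\<bar>Q\<bar>\<^sup>2\<close> equal, so integrating
  \<open>\<bar>F - Q\<bar>\<^sup>2 \<ge> 0\<close> is Bessel's inequality for \<open>F\<close>.  Domination by the polynomial \<open>P\<close>, whose
  mean square is known exactly, gives the bound on each circle of radius \<open>r < 1\<close>; then \<open>r\<close> tends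
  to 1.
\<close>

lemma coefficient_norms_le_of_dominated:
  assumes F: "F holomorphic_on ball 0 1" "F has_fps_expansion A"
    and le: "\<And>z. z \<in> ball 0 1 \<Longrightarrow> norm (F z) \<le> norm (\<Sum>n<m. p n * z ^ n)"
  shows "(\<Sum>n<N. (norm (A $ n))\<^sup>2) \<le> (\<Sum>n<m. (norm (p n))\<^sup>2)"
proof -
  define Q where "Q = (\<lambda>z. \<Sum>n<N. A $ n * z ^ n)"
  define P where "P = (\<lambda>z. \<Sum>n<m. p n * z ^ n)"
  have "(\<Sum>n<N. r ^ (2 * n) * (norm (A $ n))\<^sup>2) \<le> (\<Sum>n<m. r ^ (2 * n) * (norm (p n))\<^sup>2)"
    if r: "0 < r" "r < 1" for r :: real
  proof -
    let ?e = "circlepath 0 r"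
    define S where "S = (\<Sum>n<N. r ^ (2 * n) * (norm (A $ n))\<^sup>2)"
    define T where "T = (\<Sum>n<m. r ^ (2 * n) * (norm (p n))\<^sup>2)"
    have hol: "P holomorphic_on ball 0 1" "Q holomorphic_on ball 0 1"
      unfolding P_def Q_def by (auto intro!: holomorphic_intros)
    have sq: "of_real (x * (norm a)\<^sup>2) = of_real x * (a * cnj a)" for x a
      using complex_norm_square[of a] by simp
    have FQ: "((\<lambda>t. F (?e t) * cnj (Q (?e t))) has_integral of_real S) {0..1}"
      using circle_mean_polynomial[OF F r, where N = N and q = "\<lambda>n. A $ n"]
      unfolding Q_def S_def by (simp only: of_real_sum sq)
    have QQ: "((\<lambda>t. Q (?e t) * cnj (Q (?e t))) has_integral of_real S) {0..1}"
      using circle_mean_polynomial[OF hol(2)[unfolded Q_def] polynomial_has_fps_expansion r,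
          where N = N and q = "\<lambda>n. A $ n"]
      unfolding Q_def S_def by (simp only: of_real_sum sq) (simp cong: sum.cong_simp)
    have PP: "((\<lambda>t. P (?e t) * cnj (P (?e t))) has_integral of_real T) {0..1}"
      using circle_mean_polynomial[OF hol(1)[unfolded P_def] polynomial_has_fps_expansion r,
          where N = m and q = p]
      unfolding P_def T_def by (simp only: of_real_sum sq) (simp cong: sum.cong_simp)
    have ReE: "((\<lambda>t. Re (g t)) has_integral x) {0..1}"
      if "(g has_integral of_real x) {0..1}" for g and x :: real
      using has_integral_linear[OF that bounded_linear_Re] by (simp add: o_def)
    \<comment> \<open>Integrate the outer terms of \<open>2 Re (F \<cdot> cnj Q) - \<bar>Q\<bar>\<^sup>2 \<le> \<bar>F\<bar>\<^sup>2 \<le> \<bar>P\<bar>\<^sup>2\<close>: each is a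
      combination of products with a conjugated polynomial, whose means are known.\<close>
    have "2 * S - S \<le> T"
    proof (rule has_integral_le)
      show "((\<lambda>t. 2 * Re (F (?e t) * cnj (Q (?e t))) - Re (Q (?e t) * cnj (Q (?e t))))
              has_integral 2 * S - S) {0..1}"
        by (intro has_integral_diff has_integral_mult_right ReE FQ QQ)
      show "((\<lambda>t. Re (P (?e t) * cnj (P (?e t)))) has_integral T) {0..1}"
        by (intro ReE PP)
      fix t :: real
      let ?z = "?e t"
      have "?z \<in> ball 0 1"
        using r by (simp add: circlepath norm_mult)
      from le[OF this] have "(norm (F ?z))\<^sup>2 \<le> (norm (P ?z))\<^sup>2"
        by (simp add: P_def power_mono)
      moreover have "0 \<le> (Re (F ?z) - Re (Q ?z))\<^sup>2 + (Im (F ?z) - Im (Q ?z))\<^sup>2"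
        by simp
      ultimately show "2 * Re (F ?z * cnj (Q ?z)) - Re (Q ?z * cnj (Q ?z))
          \<le> Re (P ?z * cnj (P ?z))"
        unfolding cmod_power2 by (simp add: power2_eq_square algebra_simps)
    qed
    then show ?thesis
      by (simp add: S_def T_def)
  qed
  then have "eventually (\<lambda>r. (\<Sum>n<N. r ^ (2 * n) * (norm (A $ n))\<^sup>2) \<le>
      (\<Sum>n<m. r ^ (2 * n) * (norm (p n))\<^sup>2)) (at_left (1::real))"
    by (subst eventually_at_left[of 0]) (auto intro!: exI[of _ 0])
  moreover have "((\<lambda>r. \<Sum>n<M. r ^ (2 * n) * (b n)\<^sup>2) \<longlongrightarrow>
      (\<Sum>n<M. 1 ^ (2 * n) * (b n)\<^sup>2)) (at_left (1::real))" for M and b :: "nat \<Rightarrow> real"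
    by (intro tendsto_intros)
  ultimately have "(\<Sum>n<N. 1 ^ (2 * n) * (norm (A $ n))\<^sup>2) \<le>
      (\<Sum>n<m. 1 ^ (2 * n) * (norm (p n))\<^sup>2)"
    by (intro tendsto_le[OF trivial_limit_at_left_real])
  then show ?thesis
    by simp
qed

section \<open>Powers of starlike functions\<close>

lemma is_log_quotient_SOME:
  assumes "f \<in> starlike_class"
  shows "is_log_quotient f (SOME h. is_log_quotient f h)"
  using starlike_class_log_quotient_exists[OF assms] by (rule someI_ex)

lemma quotient_power_holomorphic:
  assumes "f \<in> starlike_class"
  shows "quotient_power \<mu> f holomorphic_on ball 0 1"
  using is_log_quotient_SOME[OF assms]
  unfolding quotient_power_def is_log_quotient_def by (auto intro!: holomorphic_intros)

lemma power_coeff_0: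
  assumes "f \<in> starlike_class"
  shows "power_coeff \<mu> f 0 = 1"
  using is_log_quotient_SOME[OF assms]
  by (simp add: power_coeff_def quotient_power_def is_log_quotient_def)

text \<open>
  If \<open>h\<close> is the logarithm of \<open>f(z)/z\<close>, then \<open>z f' / f = 1 + z h'\<close>, so the hypothesis reads
  \<open>z h' (1 - w) = 2 w\<close>; multiplying by \<open>\<mu> g\<close>, where \<open>g = exp (\<mu> h)\<close> and \<open>z g' = \<mu> z h' g\<close>,
  gives the equation without denominators.
\<close>

lemma starlike_power_differential_equation:
  assumes f: "f \<in> starlike_class" and w: "w holomorphic_on ball 0 1"
    and w_less: "\<And>z. z \<in> ball 0 1 \<Longrightarrow> norm (w z) < 1"
    and eq: "\<And>z. z \<in> ball 0 1 \<Longrightarrow>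
      (if z = 0 then 1 else z * deriv f z / f z) = (1 + w z) / (1 - w z)"
    and z: "z \<in> ball 0 1"
  shows "z * deriv (quotient_power \<mu> f) z =
       w z * (z * deriv (quotient_power \<mu> f) z + 2 * of_real \<mu> * quotient_power \<mu> f z)"
proof -
  define h where "h = (SOME h. is_log_quotient f h)"
  have "is_log_quotient f h"
    unfolding h_def by (rule is_log_quotient_SOME[OF f])
  then have h: "h holomorphic_on ball 0 1" "h 0 = 0"
    and eh: "\<And>z. z \<in> ball 0 1 \<Longrightarrow> z \<noteq> 0 \<Longrightarrow> exp (h z) = f z / z"
    by (auto simp: is_log_quotient_def)
  define g where "g = quotient_power \<mu> f"
  have g_eq: "g = (\<lambda>z. exp (of_real \<mu> * h z))"
    by (simp add: g_def quotient_power_def h_def fun_eq_iff)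
  have dh: "(h has_field_derivative deriv h z) (at z)"
    using h(1) z by (auto intro: holomorphic_derivI)
  have dg: "deriv g z = of_real \<mu> * deriv h z * g z"
    unfolding g_eq by (rule DERIV_imp_deriv) (auto intro!: derivative_eq_intros dh)
  have "z * deriv h z * (1 - w z) = 2 * w z"
  proof (cases "z = 0")
    case True
    then have "(1 + w 0) / (1 - w 0) = 1" "w 0 \<noteq> 1"
      using eq[OF z] w_less[OF z] by auto
    then show ?thesis
      using True by (simp add: field_simps)
  next
    case False
    have f_eq: "f x = x * exp (h x)" if "x \<in> ball 0 1" for x
      using eh[OF that] f by (cases "x = 0") (auto simp: starlike_class_def)
    have "((\<lambda>x. x * exp (h x)) has_field_derivative exp (h z) * (1 + z * deriv h z)) (at z)"
      by (auto intro!: derivative_eq_intros dh simp: algebra_simps)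
    then have "(f has_field_derivative exp (h z) * (1 + z * deriv h z)) (at z)"
      by (rule has_field_derivative_transform_within_open[OF _ open_ball z]) (simp add: f_eq)
    then have "z * deriv f z / f z = 1 + z * deriv h z"
      using False by (simp add: DERIV_imp_deriv f_eq[OF z])
    moreover have "w z \<noteq> 1"
      using w_less[OF z] by auto
    ultimately have "(1 + z * deriv h z) * (1 - w z) = 1 + w z"
      using eq[OF z] False by simp
    then show ?thesis
      by algebra
  qed
  then have "of_real \<mu> * g z * (z * deriv h z * (1 - w z)) = of_real \<mu> * g z * (2 * w z)"
    by simp
  moreover have "z * deriv g z - w z * (z * deriv g z + 2 * of_real \<mu> * g z) =
      of_real \<mu> * g z * (z * deriv h z * (1 - w z)) - of_real \<mu> * g z * (2 * w z)"
    unfolding dg by (simp add: algebra_simps)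
  ultimately have "z * deriv g z - w z * (z * deriv g z + 2 * of_real \<mu> * g z) = 0"
    by simp
  then show "z * deriv (quotient_power \<mu> f) z =
       w z * (z * deriv (quotient_power \<mu> f) z + 2 * of_real \<mu> * quotient_power \<mu> f z)"
    unfolding g_def[symmetric] by (simp only: right_minus_eq)
qed

text \<open>
  The differential equation in terms of coefficients.  The function \<open>w\<close> is left arbitrary because
  it serves twice: for the upper bounds, where only \<open>\<bar>w\<bar> < 1\<close> is known, and for the extremal
  functions, where \<open>w\<close> is a power of \<open>z\<close>.
\<close>

lemma power_coeff_convolution:
  assumes f: "f \<in> starlike_class" and w: "w holomorphic_on ball 0 1"
    and w_less: "\<And>z. z \<in> ball 0 1 \<Longrightarrow> norm (w z) < 1"
    and eq: "\<And>z. z \<in> ball 0 1 \<Longrightarrow>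
      (if z = 0 then 1 else z * deriv f z / f z) = (1 + w z) / (1 - w z)"
    and W: "w has_fps_expansion W"
  shows "of_nat n * power_coeff \<mu> f n =
    (W * Abs_fps (\<lambda>k. (of_nat k + 2 * of_real \<mu>) * power_coeff \<mu> f k)) $ n"
proof -
  let ?g = "quotient_power \<mu> f"
  let ?G = "Abs_fps (power_coeff \<mu> f)"
  have "?g has_fps_expansion fps_expansion ?g 0"
    using quotient_power_holomorphic[OF f]
    by (intro has_fps_expansion_fps_expansion[of "ball 0 1"]) auto
  then have G: "?g has_fps_expansion ?G"
    by (simp add: power_coeff_def[abs_def] fps_expansion_def)
  have L: "(\<lambda>z. z * deriv ?g z) has_fps_expansion fps_X * fps_deriv ?G"
    by (intro fps_expansion_intros G)
  have "(\<lambda>z. w z * (z * deriv ?g z + 2 * of_real \<mu> * ?g z)) has_fps_expansion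
      W * (fps_X * fps_deriv ?G + fps_const (2 * of_real \<mu>) * ?G)"
    by (intro fps_expansion_intros G W)
  moreover have "eventually (\<lambda>z. w z * (z * deriv ?g z + 2 * of_real \<mu> * ?g z) =
      z * deriv ?g z) (nhds 0)"
    using starlike_power_differential_equation[OF f w w_less eq, where \<mu> = \<mu>]
    by (intro eventually_nhds_in_open[THEN eventually_mono, of "ball 0 1"]) auto
  ultimately have "(\<lambda>z. z * deriv ?g z) has_fps_expansion
      W * (fps_X * fps_deriv ?G + fps_const (2 * of_real \<mu>) * ?G)"
    by (auto elim!: has_fps_expansion_cong[THEN iffD1, rotated 2])
  with L have "fps_X * fps_deriv ?G = W * (fps_X * fps_deriv ?G + fps_const (2 * of_real \<mu>) * ?G)"
    by (rule fps_expansion_unique_complex)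
  moreover have X: "(fps_X * fps_deriv ?G) $ k = of_nat k * power_coeff \<mu> f k" for k
    by (cases k) auto
  then have "fps_X * fps_deriv ?G + fps_const (2 * of_real \<mu>) * ?G =
      Abs_fps (\<lambda>k. (of_nat k + 2 * of_real \<mu>) * power_coeff \<mu> f k)"
    by (intro fps_ext) (simp add: algebra_simps)
  ultimately show ?thesis
    using X[of n] by simp
qed

text \<open>
  In the convolution with the coefficients of \<open>w\<close>, the factor with index 0 vanishes, so cutting off
  the second factor at \<open>l\<close> leaves the coefficients of the product up to index \<open>l\<close> inclusive
  unchanged.  The product \<open>F = w P\<close> with the resulting polynomial \<open>P\<close> is dominated by \<open>P\<close>.
\<close>

lemma clunie_inequality:
  assumes f: "f \<in> starlike_class"
  shows "(\<Sum>n\<le>l. (real n * norm (power_coeff \<mu> f n))\<^sup>2) \<le>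
         (\<Sum>n<l. ((real n + 2 * \<mu>) * norm (power_coeff \<mu> f n))\<^sup>2)"
proof -
  obtain w where w: "w holomorphic_on ball 0 1" "w 0 = 0"
    and wz: "\<And>z. z \<in> ball 0 1 \<Longrightarrow> norm (w z) < 1"
      "\<And>z. z \<in> ball 0 1 \<Longrightarrow>
        (if z = 0 then 1 else z * deriv f z / f z) = (1 + w z) / (1 - w z)"
    using f unfolding starlike_class_def subordinate_def by fast
  obtain W where W: "w has_fps_expansion W"
    using has_fps_expansion_fps_expansion[of "ball 0 1" w] w(1) by auto
  have W0: "W $ 0 = 0"
    using fps_nth_fps_expansion[OF W, of 0] w(2) by simp
  define K where "K = (\<lambda>n. (of_nat n + 2 * of_real \<mu>) * power_coeff \<mu> f n)"
  define P where "P = (\<lambda>z. \<Sum>n<l. K n * z ^ n)"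
  define F where "F = (\<lambda>z. w z * P z)"
  define A where "A = W * Abs_fps (\<lambda>n. if n < l then K n else 0)"
  have FA: "F holomorphic_on ball 0 1" "F has_fps_expansion A"
    unfolding F_def A_def P_def
    by (intro holomorphic_intros w fps_expansion_intros W polynomial_has_fps_expansion)+
  have "norm (F z) \<le> norm (P z)" if "z \<in> ball 0 1" for z
    using wz(1)[OF that] by (simp add: F_def norm_mult mult_left_le_one_le)
  then have le: "(\<Sum>n<Suc l. (norm (A $ n))\<^sup>2) \<le> (\<Sum>n<l. (norm (K n))\<^sup>2)"
    unfolding P_def by (rule coefficient_norms_le_of_dominated[OF FA])
  have "A $ n = of_nat n * power_coeff \<mu> f n" if "n \<le> l" for n
  proof -
    have "A $ n = (W * Abs_fps K) $ n"
      unfolding A_def fps_mult_nth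
    proof (rule sum.cong)
      fix i assume "i \<in> {0..n}"
      then show "W $ i * Abs_fps (\<lambda>n. if n < l then K n else 0) $ (n - i) = W $ i * Abs_fps K $ (n - i)"
        using W0 that by (cases "i = 0") auto
    qed simp
    then show ?thesis
      using power_coeff_convolution[OF f w(1) wz W, of n \<mu>] by (simp add: K_def)
  qed
  then have "(\<Sum>n<Suc l. (norm (A $ n))\<^sup>2) = (\<Sum>n\<le>l. (real n * norm (power_coeff \<mu> f n))\<^sup>2)"
    unfolding lessThan_Suc_atMost by (intro sum.cong) (auto simp: norm_mult)
  moreover have "(norm (K n))\<^sup>2 = ((real n + 2 * \<mu>) * norm (power_coeff \<mu> f n))\<^sup>2" for n
  proof -
    have "norm (of_nat n + 2 * of_real \<mu> :: complex) = \<bar>real n + 2 * \<mu>\<bar>"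
      by (metis (no_types) norm_of_real of_real_add of_real_mult of_real_numeral of_real_of_nat_eq)
    then show ?thesis
      by (simp add: K_def norm_mult power_mult_distrib)
  qed
  ultimately show ?thesis
    using le by simp
qed

text \<open>
  Subtracting the terms with index below \<open>l\<close> on the left of Clunie's inequality for
  \<open>\<mu> = - \<lambda>\<close> leaves the weights \<open>(n - 2\<lambda>)\<^sup>2 - n\<^sup>2 = 4 \<lambda> (\<lambda> - n)\<close>.
\<close>

lemma clunie_recursive_bound:
  assumes "f \<in> starlike_class"
  shows "(real l * norm (power_coeff (- lam) f l))\<^sup>2 \<le>
         (\<Sum>n<l. 4 * lam * (lam - real n) * (norm (power_coeff (- lam) f n))\<^sup>2)"
proof -
  let ?a = "\<lambda>n. norm (power_coeff (- lam) f n)"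
  have "(\<Sum>n<l. ((real n + 2 * - lam) * ?a n)\<^sup>2) =
      (\<Sum>n<l. (real n * ?a n)\<^sup>2) + (\<Sum>n<l. 4 * lam * (lam - real n) * (?a n)\<^sup>2)"
    unfolding sum.distrib[symmetric]
    by (intro sum.cong) (auto simp: power2_eq_square algebra_simps)
  then show ?thesis
    using clunie_inequality[OF assms, of "- lam" l]
    by (simp add: lessThan_Suc_atMost[symmetric])
qed

section \<open>Binomial coefficient bounds\<close>

text \<open>
  Writing \<open>B\<^sub>n\<close> for the binomial coefficient, \<open>(n + 1) B\<^bsub>n+1\<^esub> = (2\<lambda> - n) B\<^sub>n\<close>, hence the
  summand is \<open>(n + 1)\<^sup>2 B\<^bsub>n+1\<^esub>\<^sup>2 - n\<^sup>2 B\<^sub>n\<^sup>2\<close>.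
\<close>

lemma gbinomial_telescope:
  fixes lam :: real
  shows "(\<Sum>n<l. 4 * lam * (lam - real n) * (2 * lam gchoose n)\<^sup>2) = (real l * (2 * lam gchoose l))\<^sup>2"
proof (induction l)
  case (Suc l)
  have "real (Suc l) * (2 * lam gchoose Suc l) = (2 * lam - real l) * (2 * lam gchoose l)"
    using gbinomial_mult_1[of "2 * lam" l] by (simp add: algebra_simps)
  then show ?case
    using Suc by (simp only: sum.lessThan_Suc) (simp add: power2_eq_square algebra_simps)
qed auto

lemma gbinomial_eq_prod_quotients:
  fixes a :: real
  shows "(a gchoose l) = (\<Prod>j<l. (a - real j) / (real j + 1))"
  by (simp add: gbinomial_prod_rev fact_prod_Suc prod_dividef atLeast0LessThan add.commute)

lemma gbinomial_nonneg:
  fixes lam :: real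
  assumes "0 < lam" "real l \<le> lam + 1"
  shows "0 \<le> (2 * lam gchoose l)"
  unfolding gbinomial_eq_prod_quotients using assms
  by (intro prod_nonneg divide_nonneg_nonneg) auto

text \<open>
  For \<open>l \<le> \<lambda> + 1\<close> all indices \<open>n < l\<close> satisfy \<open>n \<le> \<lambda>\<close>, so the weights in the recursive
  bound are nonnegative and the induction hypothesis may be inserted into it.
\<close>

lemma power_coeff_le_gbinomial:
  assumes f: "f \<in> starlike_class" and lam: "0 < lam"
  shows "real l \<le> lam + 1 \<Longrightarrow> norm (power_coeff (- lam) f l) \<le> (2 * lam gchoose l)"
proof (induction l rule: less_induct)
  case (less l)
  show ?case
  proof (cases "l = 0")
    case True
    then show ?thesis
      by (simp add: power_coeff_0[OF f])
  next
    case False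
    have "(real l * norm (power_coeff (- lam) f l))\<^sup>2 \<le>
        (\<Sum>n<l. 4 * lam * (lam - real n) * (norm (power_coeff (- lam) f n))\<^sup>2)"
      by (rule clunie_recursive_bound[OF f])
    also have "\<dots> \<le> (\<Sum>n<l. 4 * lam * (lam - real n) * (2 * lam gchoose n)\<^sup>2)"
      using less lam by (intro sum_mono mult_left_mono power_mono) auto
    also have "\<dots> = (real l * (2 * lam gchoose l))\<^sup>2"
      by (rule gbinomial_telescope)
    finally have "real l * norm (power_coeff (- lam) f l) \<le> real l * (2 * lam gchoose l)"
      by (rule power2_le_imp_le) (use gbinomial_nonneg[OF lam less.prems] in simp)
    then show ?thesis
      using False by simp
  qed
qed

text \<open>
  The weights with index at least \<open>m \<ge> \<lambda>\<close> are nonpositive; without them the recursive bound is the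
  one for index \<open>m\<close>, which the binomial bounds for smaller indices control.
\<close>

lemma power_coeff_decay:
  assumes f: "f \<in> starlike_class" and lam: "0 < lam"
    and m: "lam \<le> real m" "real m \<le> lam + 1" and l: "m \<le> l"
  shows "real l * norm (power_coeff (- lam) f l) \<le> real m * (2 * lam gchoose m)"
proof (rule power2_le_imp_le)
  let ?t = "\<lambda>n. 4 * lam * (lam - real n) * (norm (power_coeff (- lam) f n))\<^sup>2"
  have "(real l * norm (power_coeff (- lam) f l))\<^sup>2 \<le> sum ?t {..<l}"
    by (rule clunie_recursive_bound[OF f])
  also have "\<dots> \<le> sum ?t {..<m}"
  proof -
    have "sum ?t ({..<l} - {..<m}) \<le> 0"
      using lam m(1) by (intro sum_nonpos mult_nonpos_nonneg mult_nonneg_nonpos) auto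
    then show ?thesis
      using sum.subset_diff[of "{..<m}" "{..<l}" ?t] l by simp
  qed
  also have "\<dots> \<le> (\<Sum>n<m. 4 * lam * (lam - real n) * (2 * lam gchoose n)\<^sup>2)"
    using lam m(2) by (intro sum_mono mult_left_mono power_mono power_coeff_le_gbinomial[OF f lam]) auto
  also have "\<dots> = (real m * (2 * lam gchoose m))\<^sup>2"
    by (rule gbinomial_telescope)
  finally show "(real l * norm (power_coeff (- lam) f l))\<^sup>2 \<le> (real m * (2 * lam gchoose m))\<^sup>2" .
  show "0 \<le> real m * (2 * lam gchoose m)"
    using gbinomial_nonneg[OF lam m(2)] by simp
qed

section \<open>Extremal functions\<close>

text \<open>
  This is \<open>z / (1 - z\<^sup>k)\<^bsup>2/k\<^esup>\<close>, the \<open>k\<close>-th root transform of the Koebe function, and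
  the Koebe function itself for \<open>k = 1\<close>.
\<close>

definition koebe_root :: "nat \<Rightarrow> complex \<Rightarrow> complex" where
  "koebe_root k z = z * exp (- (2 / of_nat k) * Ln (1 - z ^ k))"

lemma one_minus_power_notin_nonpos_Reals:
  fixes z :: complex
  assumes "z \<in> ball 0 1" "k \<ge> 1"
  shows "1 - z ^ k \<notin> \<real>\<^sub>\<le>\<^sub>0"
proof -
  have "norm z ^ k < 1"
    using assms by (simp add: power_less_one_iff)
  then have "Re (z ^ k) < 1"
    using complex_Re_le_cmod[of "z ^ k"] by (simp add: norm_power)
  then show ?thesis
    by (auto simp: complex_nonpos_Reals_iff)
qed

lemma has_field_derivative_koebe_root:
  assumes k: "k \<ge> 1" and z: "z \<in> ball 0 1"
  shows "(koebe_root k has_field_derivative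
      exp (- (2 / of_nat k) * Ln (1 - z ^ k)) * ((1 + z ^ k) / (1 - z ^ k))) (at z)"
proof -
  have nz: "1 - z ^ k \<noteq> 0" and nn: "1 - z ^ k \<notin> \<real>\<^sub>\<le>\<^sub>0"
    using one_minus_power_notin_nonpos_Reals[OF z k] by auto
  define E where "E = (\<lambda>z::complex. exp (- (2 / of_nat k) * Ln (1 - z ^ k)))"
  have "((\<lambda>z. - (2 / of_nat k) * Ln (1 - z ^ k)) has_field_derivative
      2 * z ^ (k - 1) / (1 - z ^ k)) (at z)"
    using nn nz k by (auto intro!: derivative_eq_intros simp: field_simps)
  then have "(E has_field_derivative E z * (2 * z ^ (k - 1) / (1 - z ^ k))) (at z)"
    unfolding E_def by (rule DERIV_fun_exp)
  then have "((\<lambda>z. z * E z) has_field_derivative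
      z * (E z * (2 * z ^ (k - 1) / (1 - z ^ k))) + E z) (at z)"
    by (auto intro!: derivative_eq_intros)
  also have "z * (E z * (2 * z ^ (k - 1) / (1 - z ^ k))) + E z =
      E z * (2 * (z * z ^ (k - 1)) / (1 - z ^ k) + 1)"
    by (simp add: algebra_simps)
  also have "z * z ^ (k - 1) = z ^ k"
    using k by (simp flip: power_Suc)
  also have "2 * z ^ k / (1 - z ^ k) + 1 = (1 + z ^ k) / (1 - z ^ k)"
    using nz by (simp add: field_simps)
  finally show ?thesis
    by (simp add: E_def koebe_root_def[abs_def])
qed

lemma koebe_root_starlike:
  assumes k: "k \<ge> 1"
  shows "koebe_root k \<in> starlike_class"
    and "\<And>z. z \<in> ball 0 1 \<Longrightarrow>
      (if z = 0 then 1 else z * deriv (koebe_root k) z / koebe_root k z) = (1 + z ^ k) / (1 - z ^ k)"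
proof -
  show eq: "(if z = 0 then 1 else z * deriv (koebe_root k) z / koebe_root k z) = (1 + z ^ k) / (1 - z ^ k)"
    if z: "z \<in> ball 0 1" for z
    using k DERIV_imp_deriv[OF has_field_derivative_koebe_root[OF k z]]
    by (auto simp: koebe_root_def power_0_left)
  have less: "norm (z ^ k) < 1" if "z \<in> ball 0 1" for z :: complex
    using that k by (simp add: norm_power power_less_one_iff)
  have mob: "(\<lambda>z::complex. (1 + z) / (1 - z)) holomorphic_on ball 0 1"
    by (intro holomorphic_intros) auto
  have "(\<lambda>z. (1 + z ^ k) / (1 - z ^ k)) holomorphic_on ball 0 1"
    by (intro holomorphic_intros) (use less in force)
  then have hol: "(\<lambda>z. if z = 0 then 1 else z * deriv (koebe_root k) z / koebe_root k z)
      holomorphic_on ball 0 1"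
    by (rule holomorphic_transform) (simp only: eq)
  have "koebe_root k holomorphic_on ball 0 1"
    using has_field_derivative_koebe_root[OF k] by (meson holomorphic_on_open open_ball)
  moreover have "deriv (koebe_root k) 0 = 1"
    using DERIV_imp_deriv[OF has_field_derivative_koebe_root[OF k, of 0]] k by (simp add: power_0_left)
  moreover have "subordinate (\<lambda>z. if z = 0 then 1 else z * deriv (koebe_root k) z / koebe_root k z)
      (\<lambda>z. (1 + z) / (1 - z))"
    unfolding subordinate_def
  proof (intro conjI hol mob exI[of _ "\<lambda>z. z ^ k"] ballI)
    show "(\<lambda>z::complex. z ^ k) holomorphic_on ball 0 1"
      by (intro holomorphic_intros)
  qed (use k less eq in \<open>auto simp: power_0_left\<close>)
  ultimately show "koebe_root k \<in> starlike_class"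
    by (simp add: starlike_class_def koebe_root_def)
qed

text \<open>
  For \<open>w(z) = z\<^sup>k\<close> the convolution is a shift of indices by \<open>k\<close>.
\<close>

lemma power_coeff_koebe_root:
  assumes k: "k \<ge> 1" and n: "n \<ge> k"
  shows "of_nat n * power_coeff \<mu> (koebe_root k) n =
    (of_nat (n - k) + 2 * of_real \<mu>) * power_coeff \<mu> (koebe_root k) (n - k)"
proof -
  have "of_nat n * power_coeff \<mu> (koebe_root k) n =
    (fps_X ^ k * Abs_fps (\<lambda>i. (of_nat i + 2 * of_real \<mu>) * power_coeff \<mu> (koebe_root k) i)) $ n"
  proof (rule power_coeff_convolution[OF koebe_root_starlike(1)[OF k]])
    show "(\<lambda>z::complex. z ^ k) has_fps_expansion fps_X ^ k"
      by (rule has_fps_expansion_fps_X_power)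
    show "norm (z ^ k) < 1" if "z \<in> ball 0 1" for z :: complex
      using that k by (simp add: norm_power power_less_one_iff)
  qed (use koebe_root_starlike(2)[OF k] in \<open>auto intro!: holomorphic_intros\<close>)
  then show ?thesis
    using n by (simp add: fps_X_power_mult_nth)
qed

lemma power_coeff_koebe:
  "power_coeff (- lam) (koebe_root 1) n = (- 1) ^ n * of_real (2 * lam gchoose n)"
proof (induction n)
  case 0
  show ?case
    by (simp add: power_coeff_0 koebe_root_starlike)
next
  case (Suc n)
  have "of_nat (Suc n) * power_coeff (- lam) (koebe_root 1) (Suc n) =
      (of_nat n - 2 * of_real lam) * ((- 1) ^ n * of_real (2 * lam gchoose n))"
    using power_coeff_koebe_root[of 1 "Suc n" "- lam"] Suc by simp
  also have "\<dots> = (- 1) ^ Suc n * of_real ((2 * lam - real n) * (2 * lam gchoose n))"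
    by (simp add: algebra_simps)
  also have "(2 * lam - real n) * (2 * lam gchoose n) = real (Suc n) * (2 * lam gchoose Suc n)"
    using gbinomial_mult_1[of "2 * lam" n] by (simp add: algebra_simps)
  finally have "of_nat (Suc n) * power_coeff (- lam) (koebe_root 1) (Suc n) =
      of_nat (Suc n) * ((- 1) ^ Suc n * of_real (2 * lam gchoose Suc n))"
    by (simp only: of_real_mult of_real_of_nat_eq mult_ac)
  then show ?case
    by (simp only: mult_cancel_left of_nat_eq_0_iff) simp
qed

theorem corollary2p23:
  fixes lam :: real
  assumes "0 < lam"
  shows
    "(lam \<le> 1 \<longrightarrow>
        (\<forall>f\<in>starlike_class. \<forall>l\<ge>1. norm (power_coeff (- lam) f l) \<le> 2 * lam / real l) \<and>
        (\<forall>l\<ge>1. \<exists>f\<in>starlike_class. norm (power_coeff (- lam) f l) = 2 * lam / real l)) \<and>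
     (lam > 1 \<longrightarrow>
        (\<forall>f\<in>starlike_class. \<forall>l\<in>{1..nat \<lfloor>lam\<rfloor> + 1}.
           norm (power_coeff (- lam) f l) \<le> (\<Prod>j=0..l-1. (2 * lam - real j) / (real j + 1))) \<and>
        (\<forall>f\<in>starlike_class. \<forall>l\<ge>nat \<lfloor>lam\<rfloor> + 2.
           norm (power_coeff (- lam) f l) \<le>
             ((of_int \<lfloor>lam\<rfloor> + 1) / real l) *
             (\<Prod>j=0..nat \<lfloor>lam\<rfloor>. (2 * lam - real j) / (real j + 1))) \<and>
        (\<forall>l\<in>{1..nat \<lfloor>lam\<rfloor> + 1}. \<exists>f\<in>starlike_class.
           norm (power_coeff (- lam) f l) = (\<Prod>j=0..l-1. (2 * lam - real j) / (real j + 1))))"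
proof (intro conjI impI ballI allI)
  fix f and l :: nat
  assume "lam \<le> 1" "f \<in> starlike_class" "1 \<le> l"
  then show "norm (power_coeff (- lam) f l) \<le> 2 * lam / real l"
    using power_coeff_decay[of f lam 1 l] assms by (simp add: field_simps)
next
  fix l :: nat
  assume l: "1 \<le> l"
  have "of_nat l * power_coeff (- lam) (koebe_root l) l = of_real (- 2 * lam)"
    using power_coeff_koebe_root[OF l order_refl, of "- lam"]
    by (simp add: power_coeff_0[OF koebe_root_starlike(1)[OF l]])
  then have "norm (of_nat l * power_coeff (- lam) (koebe_root l) l) = 2 * lam"
    using assms by (simp only: norm_of_real)
  then have "norm (power_coeff (- lam) (koebe_root l) l) = 2 * lam / real l"
    using l by (simp add: norm_mult field_simps)
  then show "\<exists>f\<in>starlike_class. norm (power_coeff (- lam) f l) = 2 * lam / real l"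
    using koebe_root_starlike(1)[OF l] by blast
next
  define m where "m = nat \<lfloor>lam\<rfloor> + 1"
  have m: "real m = of_int \<lfloor>lam\<rfloor> + 1" "lam \<le> real m" "real m \<le> lam + 1"
    using assms unfolding m_def by linarith+
  have prod_eq: "(\<Prod>j=0..l-1. (2 * lam - real j) / (real j + 1)) = (2 * lam gchoose l)"
    if "1 \<le> l" for l
    unfolding gbinomial_eq_prod_quotients by (rule prod.cong) (use that in auto)
  {
    fix f l
    assume f: "f \<in> starlike_class" and l: "l \<in> {1..nat \<lfloor>lam\<rfloor> + 1}"
    have "real l \<le> lam + 1"
      using l m(3) by (simp add: m_def)
    then show "norm (power_coeff (- lam) f l) \<le> (\<Prod>j=0..l-1. (2 * lam - real j) / (real j + 1))"
      using power_coeff_le_gbinomial[OF f assms] prod_eq[of l] l by simp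
  next
    fix f l
    assume f: "f \<in> starlike_class" and l: "nat \<lfloor>lam\<rfloor> + 2 \<le> l"
    have "real l * norm (power_coeff (- lam) f l) \<le> real m * (2 * lam gchoose m)"
      using l by (intro power_coeff_decay f assms m) (simp add: m_def)
    then show "norm (power_coeff (- lam) f l) \<le> ((of_int \<lfloor>lam\<rfloor> + 1) / real l) *
             (\<Prod>j=0..nat \<lfloor>lam\<rfloor>. (2 * lam - real j) / (real j + 1))"
      using l prod_eq[of m] unfolding m(1)[symmetric] by (simp add: m_def field_simps)
  next
    fix l
    assume l: "l \<in> {1..nat \<lfloor>lam\<rfloor> + 1}"
    have "0 \<le> (2 * lam gchoose l)"
      using l m(3) by (intro gbinomial_nonneg assms) (simp add: m_def)
    then have "norm (power_coeff (- lam) (koebe_root 1) l) = (2 * lam gchoose l)"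
      unfolding power_coeff_koebe norm_mult norm_power by simp
    then show "\<exists>f\<in>starlike_class. norm (power_coeff (- lam) f l) =
        (\<Prod>j=0..l-1. (2 * lam - real j) / (real j + 1))"
      using koebe_root_starlike(1)[of 1] prod_eq[of l] l by auto
  }
qed

end
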